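(* $(S^m_{nc},H_{\rm end})$ is the completion of $(S^m,H_{\rm end})$; that is, $(S^m_{nc},H_{\rm end})$ is a complete metric space containing $S^m$ as a dense subset.
   Context: A fuzzy set on $\mathbb{R}^m$ is a function $u:\mathbb{R}^m\to[0,1]$. For $\alpha\in(0,1]$, $[u]_\alpha=\{x:u(x)\ge\alpha\}$, and $[u]_0=\overline{\{x:u(x)>0\}}$. $S^m_{nc}$ (noncompact fuzzy star-shaped numbers) is the set of all fuzzy sets $u$ on $\mathbb{R}^m$ such that: $u$ is upper semi-continuous; $u$ is normal, i.e. $u(x_0)=1$ for some $x_0$; $u$ is fuzzy star-shaped, i.e. there exists $x\in\mathbb{R}^m$ such that $u(\lambda y+(1-\lambda)x)\ge u(y)$ for all $y\in\mathbb{R}^m$ and $\lambda\in[0,1]$; and $[u]_\alpha$ is bounded for each $\alpha\in(0,1]$. $S^m$ (fuzzy star-shaped numbers) is the set of those fuzzy sets satisfying the first three of these conditions and with $[u]_0$ bounded. The endograph of $u$ is ${\rm end}\,u=\{(x,t)\in\mathbb{R}^m\times[0,1]:u(x)\ge t\}$, and the endograph metric is $H_{\rm end}(u,v)=H({\rm end}\,u,{\rm end}\,v)$, where $H(A,B)=\max\{\sup_{a\in A}\inf_{b\in B}d(a,b),\ \sup_{b\in B}\inf_{a\in A}d(a,b)\}$ is the Hausdorff metric on nonempty closed sets ($d$ Euclidean). *)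

theory Defs
  imports "HOL-Analysis.Analysis"
begin

definition fuzzy_set :: "('a \<Rightarrow> real) \<Rightarrow> bool" where
  "fuzzy_set u \<longleftrightarrow> range u \<subseteq> {0..1}"

definition level_set :: "('a::topological_space \<Rightarrow> real) \<Rightarrow> real \<Rightarrow> 'a set" where
  "level_set u \<alpha> = (if \<alpha> = 0 then closure {x. u x > 0} else {x. u x \<ge> \<alpha>})"

definition upper_semicontinuous :: "('a::topological_space \<Rightarrow> real) \<Rightarrow> bool" where
  "upper_semicontinuous u \<longleftrightarrow> (\<forall>x. \<forall>e>0. eventually (\<lambda>y. u y < u x + e) (nhds x))"

definition normal_fuzzy :: "('a \<Rightarrow> real) \<Rightarrow> bool" where
  "normal_fuzzy u \<longleftrightarrow> (\<exists>x0. u x0 = 1)"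

definition fuzzy_star_shaped :: "('a::real_vector \<Rightarrow> real) \<Rightarrow> bool" where
  "fuzzy_star_shaped u \<longleftrightarrow>
     (\<exists>x. \<forall>y. \<forall>c\<in>{0..1}. u (c *\<^sub>R y + (1 - c) *\<^sub>R x) \<ge> u y)"

definition S_nc :: "(real ^ 'm \<Rightarrow> real) set" where
  "S_nc = {u. fuzzy_set u \<and> upper_semicontinuous u \<and> normal_fuzzy u \<and> fuzzy_star_shaped u
              \<and> (\<forall>\<alpha>\<in>{0<..1}. bounded (level_set u \<alpha>))}"

definition S_c :: "(real ^ 'm \<Rightarrow> real) set" where
  "S_c = {u. fuzzy_set u \<and> upper_semicontinuous u \<and> normal_fuzzy u \<and> fuzzy_star_shaped u
             \<and> bounded (level_set u 0)}"

definition endograph :: "('a \<Rightarrow> real) \<Rightarrow> ('a \<times> real) set" where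
  "endograph u = {(x, t). t \<in> {0..1} \<and> u x \<ge> t}"

definition hausdorff_distance :: "'a::metric_space set \<Rightarrow> 'a set \<Rightarrow> ennreal" where
  "hausdorff_distance A B =
     max (SUP a\<in>A. INF b\<in>B. ennreal (dist a b)) (SUP b\<in>B. INF a\<in>A. ennreal (dist a b))"

(* The endograph of a fuzzy set contains every point (x, 0), so two such endographs are nonempty
   and at Hausdorff distance at most 1; the convention enn2real top = 0 never applies to fuzzy sets.
   The distance on pairs is the Euclidean one. *)
definition H_end :: "(real ^ 'm \<Rightarrow> real) \<Rightarrow> (real ^ 'm \<Rightarrow> real) \<Rightarrow> real" where
  "H_end u v = enn2real (hausdorff_distance (endograph u) (endograph v))"

end

theory Submission
  imports Defs
begin

text \<open>
  The map sending \<open>u\<close> to its endograph turns the theorem into a statement about closed subsets of the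
  proper metric space \<open>\<real>\<^sup>m \<times> \<real>\<close> under the Hausdorff distance. A fuzzy set is determined by its
  endograph, upper semicontinuity is closedness of the endograph (\<open>upper_semicontinuous_iff\<close>), and
  \<open>H_end u v \<le> r\<close> says that every point of either endograph has distance at most \<open>r\<close> from the other
  one (\<open>H_end_le_iff\<close>). The metric axioms follow at once.

  For completeness, a Hausdorff-Cauchy sequence of closed sets in a proper space converges to the set
  of points whose distance from the sequence tends to \<open>0\<close>. This set also contains every limit of points
  taken along a mere subsequence (\<open>subsequence_limit_in_closed_limit\<close>), which is what makes its structure
  accessible: closedness, the downward closure in the last coordinate and the presence of
  \<open>\<real>\<^sup>m \<times> {0}\<close> pass to the limit, so the limit is the endograph of a fuzzy set \<open>v\<close>
  (\<open>endograph_upper_envelope\<close>). The remaining difficulty is that normality and star-shapedness need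
  convergent witnesses. A star centre \<open>x\<^sub>n\<close> of the \<open>n\<close>-th term has membership \<open>1\<close>, so it lies within
  \<open>1/2\<close> of the bounded \<open>1/2\<close>-level of one fixed term once \<open>n\<close> is large; hence the centres subconverge, and
  the limit of a subsequence is both a point of membership \<open>1\<close> and a star centre of \<open>v\<close>. The same
  comparison, with half the level in place of \<open>1/2\<close>, bounds the level sets of \<open>v\<close>.

  For density, set \<open>u\<close> to \<open>0\<close> wherever it is below \<open>\<epsilon>\<close>. This only removes points of the endograph that lie
  within \<open>\<epsilon>\<close> of \<open>\<real>\<^sup>m \<times> {0}\<close>, and leaves a support contained in the bounded \<open>\<epsilon>\<close>-level of \<open>u\<close>.
\<close>

section \<open>Hausdorff distance through the distance to a set\<close>

lemma infdist_lessE: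
  assumes "A \<noteq> {}" "infdist x A < r"
  obtains a where "a \<in> A" "dist x a < r"
  using assms by (auto simp: infdist_notempty cINF_less_iff)

lemma infdist_le_via:
  assumes "B \<noteq> {}" and "\<And>b. b \<in> B \<Longrightarrow> infdist b C \<le> r"
  shows "infdist x C \<le> infdist x B + r"
proof (rule field_le_epsilon)
  fix e :: real assume "0 < e"
  then obtain b where b: "b \<in> B" "dist x b < infdist x B + e"
    using infdist_lessE[OF assms(1), of x "infdist x B + e"] by auto
  then show "infdist x C \<le> infdist x B + r + e"
    using infdist_triangle[of x C b] assms(2)[OF b(1)] by linarith
qed

lemma INF_ennreal_dist:
  assumes "A \<noteq> {}"
  shows "(INF a\<in>A. ennreal (dist x a)) = ennreal (infdist x A)"
proof (rule antisym)
  show "ennreal (infdist x A) \<le> (INF a\<in>A. ennreal (dist x a))"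
    by (auto intro!: INF_greatest ennreal_leI infdist_le)
  show "(INF a\<in>A. ennreal (dist x a)) \<le> ennreal (infdist x A)"
  proof (rule ennreal_le_epsilon)
    fix e :: real assume "0 < e"
    then obtain a where "a \<in> A" "dist x a < infdist x A + e"
      using infdist_lessE[OF assms, of x "infdist x A + e"] by auto
    then have "(INF a\<in>A. ennreal (dist x a)) \<le> ennreal (infdist x A + e)"
      by (intro INF_lower2[of a] ennreal_leI) auto
    then show "(INF a\<in>A. ennreal (dist x a)) \<le> ennreal (infdist x A) + ennreal e"
      using \<open>0 < e\<close> by (simp add: ennreal_plus infdist_nonneg)
  qed
qed

lemma hausdorff_distance_le_iff:
  assumes "A \<noteq> {}" "B \<noteq> {}" "0 \<le> r"
  shows "hausdorff_distance A B \<le> ennreal r \<longleftrightarrow>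
    (\<forall>a\<in>A. infdist a B \<le> r) \<and> (\<forall>b\<in>B. infdist b A \<le> r)"
proof -
  have "(INF a\<in>A. ennreal (dist a b)) = ennreal (infdist b A)" for b
    using INF_ennreal_dist[OF assms(1), of b] by (simp add: dist_commute)
  then show ?thesis
    using assms by (simp add: hausdorff_distance_def INF_ennreal_dist SUP_le_iff ennreal_le_iff)
qed

lemma hausdorff_distance_commute: "hausdorff_distance A B = hausdorff_distance B A"
proof -
  have swap: "(SUP a\<in>X. INF b\<in>Y. ennreal (dist a b)) = (SUP a\<in>X. INF b\<in>Y. ennreal (dist b a))"
    for X Y :: "'a set"
    by (subst dist_commute) (rule refl)
  show ?thesis
    unfolding hausdorff_distance_def swap[of A B] swap[of B A] by (rule max.commute)
qed

section \<open>Limits of Hausdorff-Cauchy sequences of closed sets\<close>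

text \<open>
  For nonempty \<open>E n\<close> this is the Kuratowski lower limit: the limits of convergent sequences that choose
  one point from every \<open>E n\<close>. Phrasing it through the distance makes the Lipschitz bounds on
  \<^const>\<open>infdist\<close> directly applicable.
\<close>

definition closed_limit :: "(nat \<Rightarrow> 'a::metric_space set) \<Rightarrow> 'a set" where
  "closed_limit E = {a. (\<lambda>n. infdist a (E n)) \<longlonglongrightarrow> 0}"

definition hausdorff_Cauchy :: "(nat \<Rightarrow> 'a::metric_space set) \<Rightarrow> bool" where
  "hausdorff_Cauchy E \<longleftrightarrow>
    (\<forall>e>0. \<exists>N. \<forall>m\<ge>N. \<forall>n\<ge>N. \<forall>a. infdist a (E n) \<le> infdist a (E m) + e)"

lemma closed_limitI:
  assumes "\<And>e. 0 < e \<Longrightarrow> \<forall>\<^sub>F n in sequentially. infdist a (E n) < e"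
  shows "a \<in> closed_limit E"
  unfolding closed_limit_def tendsto_iff using assms by (simp add: infdist_nonneg)

lemma eventually_infdist_closed_limit:
  assumes "a \<in> closed_limit E" "0 < e"
  shows "\<forall>\<^sub>F n in sequentially. infdist a (E n) < e"
  using assms unfolding closed_limit_def tendsto_iff by (simp add: infdist_nonneg)

lemma closed_closed_limit: "closed (closed_limit E)"
proof -
  have "a \<in> closed_limit E" if a: "a \<in> closure (closed_limit E)" for a
  proof (rule closed_limitI)
    fix e :: real assume "0 < e"
    then obtain b where b: "b \<in> closed_limit E" "dist b a < e / 2"
      using a unfolding closure_approachable by (meson half_gt_zero)
    from \<open>0 < e\<close> have "\<forall>\<^sub>F n in sequentially. infdist b (E n) < e / 2"
      by (intro eventually_infdist_closed_limit[OF b(1)]) simp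
    then show "\<forall>\<^sub>F n in sequentially. infdist a (E n) < e"
    proof eventually_elim
      case (elim n)
      then show ?case
        using infdist_triangle[of a "E n" b] b(2) by (simp add: dist_commute)
    qed
  qed
  then show ?thesis
    using closure_subset_eq by blast
qed

text \<open>The Cauchy property upgrades closeness to infinitely many terms to closeness to almost all.\<close>

lemma subsequence_limit_in_closed_limit:
  assumes "hausdorff_Cauchy E" "strict_mono r"
    and "\<And>k. a k \<in> E (r k)" "a \<longlonglongrightarrow> l"
  shows "l \<in> closed_limit E"
proof (rule closed_limitI)
  fix e :: real assume "0 < e"
  then obtain N where N: "\<And>m n b. N \<le> m \<Longrightarrow> N \<le> n \<Longrightarrow> infdist b (E n) \<le> infdist b (E m) + e / 2"
    using assms(1) unfolding hausdorff_Cauchy_def by (meson half_gt_zero)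
  have "\<forall>\<^sub>F k in sequentially. dist (a k) l < e / 2 \<and> N \<le> k"
    using assms(4) \<open>0 < e\<close> by (intro eventually_conj tendstoD eventually_ge_at_top) auto
  then obtain k where k: "dist (a k) l < e / 2" "N \<le> k"
    by (auto simp: eventually_sequentially)
  have "N \<le> r k"
    using k(2) seq_suble[OF assms(2)] order_trans by blast
  moreover have "infdist l (E (r k)) < e / 2"
    using infdist_le[OF assms(3), of l k] k(1) by (simp add: dist_commute)
  ultimately have "infdist l (E n) < e" if "N \<le> n" for n
    using N[of "r k" n l] that by simp
  then show "\<forall>\<^sub>F n in sequentially. infdist l (E n) < e"
    by (auto simp: eventually_sequentially)
qed

lemma closed_limit_sequence:
  fixes E :: "nat \<Rightarrow> 'a::heine_borel set"
  assumes "\<And>n. closed (E n)" "\<And>n. E n \<noteq> {}" "a \<in> closed_limit E"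
  obtains b where "\<And>n. b n \<in> E n" "b \<longlonglongrightarrow> a"
proof -
  have "\<forall>n. \<exists>b\<in>E n. infdist a (E n) = dist a b"
    using infdist_attains_inf[OF assms(1,2)] by metis
  then obtain b where b: "\<And>n. b n \<in> E n" "\<And>n. infdist a (E n) = dist a (b n)"
    by metis
  have "(\<lambda>n. dist (b n) a) \<longlonglongrightarrow> 0"
    using assms(3) b(2) by (simp add: closed_limit_def dist_commute)
  then show thesis
    using that b(1) tendsto_dist_iff by blast
qed

text \<open>
  Both halves of Hausdorff convergence come from one Cauchy index. From a point of the limit the bound
  is obtained by letting one index tend to infinity; from a point of a late term, compactness of bounded
  sets produces an accumulation point of its nearest points in the later terms.
\<close>

lemma closed_limit_hausdorff:
  fixes E :: "nat \<Rightarrow> 'a::heine_borel set"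
  assumes cauchy: "hausdorff_Cauchy E" and cl: "\<And>n. closed (E n)" and ne: "\<And>n. E n \<noteq> {}"
    and "0 < e"
  shows "\<forall>\<^sub>F n in sequentially.
    (\<forall>a\<in>E n. infdist a (closed_limit E) \<le> e) \<and> (\<forall>a\<in>closed_limit E. infdist a (E n) \<le> e)"
proof -
  obtain N where N: "\<And>m n a. N \<le> m \<Longrightarrow> N \<le> n \<Longrightarrow> infdist a (E n) \<le> infdist a (E m) + e"
    using cauchy \<open>0 < e\<close> unfolding hausdorff_Cauchy_def by meson
  have "infdist a (closed_limit E) \<le> e" if n: "N \<le> n" and a: "a \<in> E n" for a n
  proof -
    have "\<exists>b\<in>E (N + k). dist a b \<le> e" for k
    proof -
      have "infdist a (E (N + k)) \<le> e"
        using N[of n "N + k" a] n a by simp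
      then show ?thesis
        using infdist_attains_inf[OF cl ne] by metis
    qed
    then obtain b where b: "\<And>k. b k \<in> E (N + k)" "\<And>k. dist a (b k) \<le> e"
      by metis
    have "bounded (range b)"
      using b(2) by (auto simp: bounded_def)
    then obtain l r where r: "strict_mono r" and l: "(b \<circ> r) \<longlonglongrightarrow> l"
      using bounded_imp_convergent_subsequence by blast
    have "l \<in> closed_limit E"
    proof (rule subsequence_limit_in_closed_limit[OF cauchy])
      show "strict_mono (\<lambda>k. N + r k)"
        using r by (simp add: strict_mono_def)
      show "(b \<circ> r) k \<in> E (N + r k)" for k
        using b(1) by simp
    qed (rule l)
    moreover have "dist a l \<le> e"
    proof (rule tendsto_upperbound)
      show "(\<lambda>k. dist a ((b \<circ> r) k)) \<longlonglongrightarrow> dist a l"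
        by (intro tendsto_intros l)
    qed (use b(2) in auto)
    ultimately show ?thesis
      by (rule infdist_le2)
  qed
  moreover have "infdist a (E n) \<le> e" if n: "N \<le> n" and a: "a \<in> closed_limit E" for a n
  proof (rule field_le_epsilon)
    fix d :: real assume "0 < d"
    have "\<forall>\<^sub>F m in sequentially. infdist a (E m) < d \<and> N \<le> m"
      by (intro eventually_conj eventually_infdist_closed_limit[OF a] \<open>0 < d\<close> eventually_ge_at_top)
    then obtain m where "infdist a (E m) < d" "N \<le> m"
      by (auto simp: eventually_sequentially)
    then show "infdist a (E n) \<le> e + d"
      using N[of m n a] n by linarith
  qed
  ultimately show ?thesis
    unfolding eventually_sequentially by blast
qed

section \<open>Fuzzy sets and their endographs\<close>

lemma fuzzy_setD: "fuzzy_set u \<Longrightarrow> 0 \<le> u x" "fuzzy_set u \<Longrightarrow> u x \<le> 1"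
  unfolding fuzzy_set_def by (auto simp: image_subset_iff)

lemma mem_endograph: "(x, t) \<in> endograph u \<longleftrightarrow> 0 \<le> t \<and> t \<le> 1 \<and> t \<le> u x"
  by (auto simp: endograph_def)

lemma endograph_ground: "fuzzy_set u \<Longrightarrow> (x, 0) \<in> endograph u"
  by (simp add: mem_endograph fuzzy_setD)

lemma endograph_nonempty: "fuzzy_set u \<Longrightarrow> endograph u \<noteq> {}"
  by (metis endograph_ground empty_iff)

lemma endograph_inject:
  assumes "fuzzy_set u" "fuzzy_set v" "endograph u = endograph v"
  shows "u = v"
proof
  fix x
  have "(x, u x) \<in> endograph u" "(x, v x) \<in> endograph v"
    using assms(1,2) by (simp_all add: mem_endograph fuzzy_setD)
  then have "(x, u x) \<in> endograph v" "(x, v x) \<in> endograph u"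
    using assms(3) by simp_all
  then show "u x = v x"
    by (simp add: mem_endograph)
qed

lemma upper_semicontinuous_iff:
  fixes u :: "'a::metric_space \<Rightarrow> real"
  assumes "fuzzy_set u"
  shows "upper_semicontinuous u \<longleftrightarrow> closed (endograph u)"
proof
  assume usc: "upper_semicontinuous u"
  have "(x, t) \<in> endograph u"
    if lim: "f \<longlonglongrightarrow> (x, t)" and f: "\<And>n. f n \<in> endograph u" for f x t
  proof -
    have x: "(\<lambda>n. fst (f n)) \<longlonglongrightarrow> x" and t: "(\<lambda>n. snd (f n)) \<longlonglongrightarrow> t"
      using tendsto_fst[OF lim] tendsto_snd[OF lim] by simp_all
    have f': "0 \<le> snd (f n)" "snd (f n) \<le> 1" "snd (f n) \<le> u (fst (f n))" for n
      using f[of n] mem_endograph[of "fst (f n)" "snd (f n)" u] by simp_all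
    have "t \<le> u x + e" if "0 < e" for e
    proof (rule tendsto_upperbound[OF t])
      have "\<forall>\<^sub>F n in sequentially. u (fst (f n)) < u x + e"
        using usc that eventually_compose_filterlim[OF _ x] unfolding upper_semicontinuous_def by blast
      then show "\<forall>\<^sub>F n in sequentially. snd (f n) \<le> u x + e"
      proof eventually_elim
        case (elim n)
        then show ?case using f'(3)[of n] by linarith
      qed
    qed simp
    then have "t \<le> u x"
      by (rule field_le_epsilon)
    moreover have "0 \<le> t" "t \<le> 1"
      using tendsto_lowerbound[OF t] tendsto_upperbound[OF t] f'(1,2) by auto
    ultimately show ?thesis
      by (simp add: mem_endograph)
  qed
  then show "closed (endograph u)"
    unfolding closed_sequential_limits by (metis surj_pair)
next
  assume cl: "closed (endograph u)"
  show "upper_semicontinuous u"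
    unfolding upper_semicontinuous_def
  proof (intro allI impI)
    fix x and e :: real assume "0 < e"
    show "\<forall>\<^sub>F y in nhds x. u y < u x + e"
    proof (cases "u x + e \<le> 1")
      case True
      have "open ((\<lambda>y. (y, u x + e)) -` (- endograph u))"
        using cl by (intro open_vimage open_Compl continuous_intros)
      moreover have "x \<in> (\<lambda>y. (y, u x + e)) -` (- endograph u)"
        using \<open>0 < e\<close> by (simp add: mem_endograph)
      ultimately have "\<forall>\<^sub>F y in nhds x. (y, u x + e) \<notin> endograph u"
        by (auto simp: eventually_nhds)
      then show ?thesis
      proof eventually_elim
        case (elim y)
        then show ?case
          using True \<open>0 < e\<close> fuzzy_setD[OF assms, of x] by (simp add: mem_endograph)
      qed
    next
      case False
      then show ?thesis
        using fuzzy_setD(2)[OF assms] by (intro always_eventually allI) (meson le_less_trans not_le)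
    qed
  qed
qed

text \<open>This recovers a fuzzy set from a limit of endographs. Closedness of \<open>L\<close> is what makes the supremum
  of each fibre belong to the fibre, so that nothing is added to \<open>L\<close> by passing to the endograph.\<close>

definition upper_envelope :: "('a \<times> real) set \<Rightarrow> 'a \<Rightarrow> real" where
  "upper_envelope L x = Sup {t. (x, t) \<in> L}"

lemma
  fixes L :: "('a::metric_space \<times> real) set"
  assumes cl: "closed L"
    and range: "\<And>x t. (x, t) \<in> L \<Longrightarrow> 0 \<le> t \<and> t \<le> 1"
    and ground: "\<And>x. (x, 0) \<in> L"
    and down: "\<And>x s t. (x, t) \<in> L \<Longrightarrow> 0 \<le> s \<Longrightarrow> s \<le> t \<Longrightarrow> (x, s) \<in> L"
  shows endograph_upper_envelope: "endograph (upper_envelope L) = L"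
    and fuzzy_set_upper_envelope: "fuzzy_set (upper_envelope L)"
proof -
  have bdd: "bdd_above {t. (x, t) \<in> L}" for x
    using range by (auto intro: bdd_aboveI[where M = 1])
  have top: "(x, upper_envelope L x) \<in> L" for x
  proof -
    have "closed ((\<lambda>t. (x, t)) -` L)"
      using cl by (intro closed_vimage continuous_intros)
    then have "closed {t. (x, t) \<in> L}"
      by (simp add: vimage_def)
    then have "Sup {t. (x, t) \<in> L} \<in> {t. (x, t) \<in> L}"
      using ground bdd by (intro closed_contains_Sup) auto
    then show ?thesis
      by (simp add: upper_envelope_def)
  qed
  have upper: "t \<le> upper_envelope L x" if "(x, t) \<in> L" for x t
    unfolding upper_envelope_def using that bdd by (intro cSup_upper) auto
  show "endograph (upper_envelope L) = L"
    using range upper down[OF top] by (auto simp: endograph_def)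
  show "fuzzy_set (upper_envelope L)"
    using range[OF top] by (auto simp: fuzzy_set_def)
qed

text \<open>A star centre is a mode: contracting a point of membership \<open>1\<close> all the way to the centre cannot
  lower its membership. Star-shapedness and normality therefore share one witness.\<close>

lemma star_centre_exists:
  assumes "fuzzy_set u" "normal_fuzzy u" "fuzzy_star_shaped u"
  shows "\<exists>x. u x = 1 \<and> (\<forall>y. \<forall>c\<in>{0..1}. u y \<le> u (c *\<^sub>R y + (1 - c) *\<^sub>R x))"
proof -
  obtain x where x: "\<forall>y. \<forall>c\<in>{0..1}. u y \<le> u (c *\<^sub>R y + (1 - c) *\<^sub>R x)"
    using assms(3) unfolding fuzzy_star_shaped_def by blast
  obtain x0 where x0: "u x0 = 1"
    using assms(2) unfolding normal_fuzzy_def by blast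
  have "u x0 \<le> u (0 *\<^sub>R x0 + (1 - 0) *\<^sub>R x)"
    by (rule x[THEN spec, THEN bspec]) simp
  then have "u x = 1"
    using x0 fuzzy_setD(2)[OF assms(1), of x] by simp
  with x show ?thesis
    by blast
qed

section \<open>The endograph metric\<close>

lemma H_end_le_iff:
  assumes "fuzzy_set u" "fuzzy_set v" "0 \<le> r"
  shows "H_end u v \<le> r \<longleftrightarrow>
    (\<forall>a\<in>endograph u. infdist a (endograph v) \<le> r) \<and> (\<forall>b\<in>endograph v. infdist b (endograph u) \<le> r)"
proof -
  \<comment> \<open>The ground plane is common to all endographs and is at distance at most \<open>1\<close> from every point of
    them; so the distance is finite and the conversion to a real number loses nothing.\<close>
  have one: "infdist a (endograph q) \<le> 1" if "fuzzy_set q" "a \<in> endograph p"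
    for p q :: "real ^ 'm \<Rightarrow> real" and a
  proof -
    obtain x t where a: "a = (x, t)" by fastforce
    then have "dist a (x, 0) \<le> 1"
      using that(2) by (simp add: dist_Pair_Pair mem_endograph)
    then show ?thesis
      using infdist_le2 endograph_ground[OF that(1)] by blast
  qed
  have "hausdorff_distance (endograph u) (endograph v) \<le> ennreal 1"
    using one assms by (subst hausdorff_distance_le_iff) (auto simp: endograph_nonempty)
  then have fin: "hausdorff_distance (endograph u) (endograph v) < top"
    using ennreal_less_top le_less_trans by blast
  then have "H_end u v \<le> r \<longleftrightarrow> hausdorff_distance (endograph u) (endograph v) \<le> ennreal r"
    unfolding H_end_def using assms(3)
    by (metis enn2real_leI ennreal_enn2real ennreal_leI)
  then show ?thesis
    using assms by (simp add: hausdorff_distance_le_iff endograph_nonempty)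
qed

lemma H_end_nonneg: "0 \<le> H_end u v"
  by (simp add: H_end_def)

lemma H_end_commute: "H_end u v = H_end v u"
  by (simp add: H_end_def hausdorff_distance_commute)

lemma infdist_endograph_le:
  assumes "fuzzy_set u" "fuzzy_set v"
  shows "infdist a (endograph v) \<le> infdist a (endograph u) + H_end u v"
proof (rule infdist_le_via)
  show "endograph u \<noteq> {}"
    by (rule endograph_nonempty[OF assms(1)])
  show "infdist b (endograph v) \<le> H_end u v" if "b \<in> endograph u" for b
    using H_end_le_iff[OF assms H_end_nonneg[of u v]] that by simp
qed

lemma H_end_triangle:
  assumes "fuzzy_set u" "fuzzy_set v" "fuzzy_set w"
  shows "H_end u w \<le> H_end u v + H_end v w"
proof -
  have "infdist a (endograph w) \<le> H_end u v + H_end v w" if "a \<in> endograph u" for a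
    using infdist_endograph_le[OF assms(1,2), of a] infdist_endograph_le[OF assms(2,3), of a] that
    by simp
  moreover have "infdist a (endograph u) \<le> H_end u v + H_end v w" if "a \<in> endograph w" for a
    using infdist_endograph_le[OF assms(3,2), of a] infdist_endograph_le[OF assms(2,1), of a] that
    by (simp add: H_end_commute)
  ultimately show ?thesis
    using assms by (simp add: H_end_le_iff H_end_nonneg)
qed

lemma H_end_eq_0_iff:
  fixes u v :: "real ^ 'm \<Rightarrow> real"
  assumes "fuzzy_set u" "fuzzy_set v" "closed (endograph u)" "closed (endograph v)"
  shows "H_end u v = 0 \<longleftrightarrow> u = v"
proof -
  have mem: "infdist a A \<le> 0 \<longleftrightarrow> a \<in> A" if "closed A" "A \<noteq> {}" for a and A :: "((real ^ 'm) \<times> real) set"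
    using that by (metis in_closed_iff_infdist_zero infdist_nonneg order_antisym order_refl)
  have "H_end u v = 0 \<longleftrightarrow> H_end u v \<le> 0"
    using H_end_nonneg[of u v] by linarith
  also have "\<dots> \<longleftrightarrow> endograph u = endograph v"
    using assms by (auto simp: H_end_le_iff mem endograph_nonempty)
  also have "\<dots> \<longleftrightarrow> u = v"
    using assms endograph_inject by blast
  finally show ?thesis .
qed

text \<open>A point within \<open>\<alpha>/2\<close> of one at height \<open>\<alpha>\<close> still has height above \<open>\<alpha>/2\<close>, so boundedness of a level set
  transfers between nearby fuzzy sets at the cost of halving the level.\<close>

lemma bounded_level_nearby:
  fixes u :: "real ^ 'm \<Rightarrow> real"
  assumes "fuzzy_set u" and bdd: "bounded {x. \<alpha> / 2 \<le> u x}" and "0 < \<alpha>" "\<alpha> \<le> 1"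
  shows "bounded {x. \<exists>v. fuzzy_set v \<and> \<alpha> \<le> v x \<and> H_end v u < \<alpha> / 2}"
proof -
  obtain R where R: "\<And>x. \<alpha> / 2 \<le> u x \<Longrightarrow> dist 0 x \<le> R"
    using bdd unfolding bounded_any_center[of _ 0] by auto
  have "dist 0 x \<le> R + \<alpha> / 2" if v: "fuzzy_set v" "\<alpha> \<le> v x" "H_end v u < \<alpha> / 2" for x v
  proof -
    have "(x, \<alpha>) \<in> endograph v"
      using v(2) assms by (simp add: mem_endograph)
    then have "infdist (x, \<alpha>) (endograph u) < \<alpha> / 2"
      using infdist_endograph_le[OF v(1) assms(1), of "(x, \<alpha>)"] v(3) by simp
    then obtain y s where ys: "(y, s) \<in> endograph u" "dist (x, \<alpha>) (y, s) < \<alpha> / 2"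
      using infdist_lessE[OF endograph_nonempty[OF assms(1)]] by (metis surj_pair)
    have "dist x y < \<alpha> / 2" "dist \<alpha> s < \<alpha> / 2"
      using ys(2) dist_fst_le[of "(x, \<alpha>)" "(y, s)"] dist_snd_le[of "(x, \<alpha>)" "(y, s)"] by simp_all
    moreover from this(2) have "\<alpha> / 2 \<le> u y"
      using ys(1) abs_ge_self[of "\<alpha> - s"] unfolding mem_endograph dist_real_def by linarith
    ultimately show ?thesis
      using R[of y] dist_triangle[of 0 x y] by (simp add: dist_commute)
  qed
  then show ?thesis
    unfolding bounded_any_center[of _ 0] by blast
qed

section \<open>Completeness of the noncompact fuzzy star-shaped numbers\<close>

lemma S_nc_iff:
  "u \<in> S_nc \<longleftrightarrow> fuzzy_set u \<and> closed (endograph u) \<and> normal_fuzzy u \<and> fuzzy_star_shaped u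
    \<and> (\<forall>\<alpha>\<in>{0<..1}. bounded {x. \<alpha> \<le> u x})"
  unfolding S_nc_def level_set_def by (auto simp: upper_semicontinuous_iff)

lemma S_nc_bounded_level: "u \<in> S_nc \<Longrightarrow> 0 < \<alpha> \<Longrightarrow> \<alpha> \<le> 1 \<Longrightarrow> bounded {x. \<alpha> \<le> u x}"
  by (simp add: S_nc_iff)

lemma Metric_space_S_nc: "Metric_space S_nc H_end"
  by standard (auto simp: S_nc_iff H_end_nonneg H_end_eq_0_iff intro: H_end_commute H_end_triangle)

lemma S_nc_Cauchy_converges:
  fixes u :: "nat \<Rightarrow> real ^ 'm \<Rightarrow> real"
  assumes u: "\<And>n. u n \<in> S_nc"
    and cauchy: "\<And>e. 0 < e \<Longrightarrow> \<exists>N. \<forall>m\<ge>N. \<forall>n\<ge>N. H_end (u m) (u n) < e"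
  obtains v where "v \<in> S_nc" "\<And>e. 0 < e \<Longrightarrow> \<forall>\<^sub>F n in sequentially. H_end (u n) v \<le> e"
proof -
  define E where "E n = endograph (u n)" for n
  define L where "L = closed_limit E"
  define v where "v = upper_envelope L"
  have fz: "fuzzy_set (u n)" for n
    using u by (simp add: S_nc_iff)
  have cl: "closed (E n)" and ne: "E n \<noteq> {}" for n
    using u[of n] by (simp_all add: E_def S_nc_iff endograph_nonempty)
  have hC: "hausdorff_Cauchy E"
    unfolding hausdorff_Cauchy_def
  proof (intro allI impI)
    fix e :: real assume "0 < e"
    then obtain N where N: "\<And>m n. N \<le> m \<Longrightarrow> N \<le> n \<Longrightarrow> H_end (u m) (u n) < e"
      using cauchy by meson
    have "infdist a (E n) \<le> infdist a (E m) + e" if "N \<le> m" "N \<le> n" for m n a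
      using infdist_endograph_le[OF fz fz, of a n m] N[OF that] by (simp add: E_def)
    then show "\<exists>N. \<forall>m\<ge>N. \<forall>n\<ge>N. \<forall>a. infdist a (E n) \<le> infdist a (E m) + e"
      by blast
  qed
  have L_seq: "\<exists>y s. (\<forall>n. (y n, s n) \<in> E n) \<and> y \<longlonglongrightarrow> x \<and> s \<longlonglongrightarrow> t" if xt: "(x, t) \<in> L" for x t
  proof -
    obtain b where b: "\<And>n. b n \<in> E n" "b \<longlonglongrightarrow> (x, t)"
      using closed_limit_sequence[where E = E, OF cl ne xt[unfolded L_def]] by blast
    then show ?thesis
      using tendsto_fst[OF b(2)] tendsto_snd[OF b(2)]
      by (intro exI[of _ "\<lambda>n. fst (b n)"] exI[of _ "\<lambda>n. snd (b n)"]) simp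
  qed
  have L_subseq: "(x, t) \<in> L"
    if "strict_mono r" "\<And>k. (y k, s k) \<in> E (r k)" "y \<longlonglongrightarrow> x" "s \<longlonglongrightarrow> t" for r y s x t
    unfolding L_def using that
    by (intro subsequence_limit_in_closed_limit[OF hC, of r "\<lambda>k. (y k, s k)"] tendsto_Pair)
  have L_lim: "(x, t) \<in> L"
    if "\<And>n. (y n, s n) \<in> E n" "y \<longlonglongrightarrow> x" "s \<longlonglongrightarrow> t" for y s x t
    using that by (intro L_subseq[of id]) (auto simp: strict_mono_def)

  have "closed L"
    by (simp add: L_def closed_closed_limit)
  moreover have "0 \<le> t \<and> t \<le> 1" if xt: "(x, t) \<in> L" for x t
  proof -
    obtain y s where ys: "\<And>n. (y n, s n) \<in> E n" and t: "s \<longlonglongrightarrow> t"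
      using L_seq[OF xt] by blast
    have "0 \<le> s n" "s n \<le> 1" for n
      using ys[of n] by (simp_all add: E_def mem_endograph)
    then show ?thesis
      using tendsto_lowerbound[OF t] tendsto_upperbound[OF t] by auto
  qed
  moreover have "(x, 0) \<in> L" for x
    by (rule L_lim[of "\<lambda>_. x" "\<lambda>_. 0"]) (simp_all add: E_def endograph_ground fz)
  moreover have "(x, t') \<in> L" if xt: "(x, t) \<in> L" and t': "0 \<le> t'" "t' \<le> t" for x t t'
  proof -
    obtain y s where ys: "\<And>n. (y n, s n) \<in> E n" and x: "y \<longlonglongrightarrow> x" and t: "s \<longlonglongrightarrow> t"
      using L_seq[OF xt] by blast
    show ?thesis
    proof (rule L_lim[of y "\<lambda>n. min (s n) t'"])
      show "(y n, min (s n) t') \<in> E n" for n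
        using ys[of n] t'(1) by (auto simp: E_def mem_endograph)
      show "(\<lambda>n. min (s n) t') \<longlonglongrightarrow> t'"
        using tendsto_min[OF t tendsto_const[of t']] t'(2) by simp
    qed (rule x)
  qed
  ultimately have end_v: "endograph v = L" and fz_v: "fuzzy_set v"
    unfolding v_def by (rule endograph_upper_envelope fuzzy_set_upper_envelope; blast)+

  have conv: "\<forall>\<^sub>F n in sequentially. H_end (u n) v \<le> e" if "0 < e" for e
    using closed_limit_hausdorff[OF hC cl ne that]
  proof eventually_elim
    case (elim n)
    then show ?case
      using that by (simp add: H_end_le_iff fz fz_v end_v flip: E_def L_def)
  qed

  have levels: "bounded {x. \<alpha> \<le> v x}" if \<alpha>: "0 < \<alpha>" "\<alpha> \<le> 1" for \<alpha>
  proof -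
    obtain n where "H_end (u n) v \<le> \<alpha> / 4"
      using conv[of "\<alpha> / 4"] \<alpha> by (auto simp: eventually_sequentially)
    then have "H_end v (u n) < \<alpha> / 2"
      using \<alpha> by (simp add: H_end_commute[of v])
    then have near: "{x. \<alpha> \<le> v x} \<subseteq> {x. \<exists>w. fuzzy_set w \<and> \<alpha> \<le> w x \<and> H_end w (u n) < \<alpha> / 2}"
      using fz_v by blast
    have "bounded {x. \<alpha> / 2 \<le> u n x}"
      using \<alpha> by (intro S_nc_bounded_level[OF u]) auto
    from bounded_subset[OF bounded_level_nearby[OF fz this \<alpha>] near] show ?thesis .
  qed

  \<comment> \<open>All centres from index \<open>N\<close> on have membership \<open>1\<close> in some fuzzy set near \<open>u N\<close>, so they stay bounded.\<close>
  have "\<forall>n. \<exists>x. u n x = 1 \<and> (\<forall>y. \<forall>c\<in>{0..1}. u n y \<le> u n (c *\<^sub>R y + (1 - c) *\<^sub>R x))"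
    using u by (intro allI star_centre_exists) (simp_all add: S_nc_iff)
  from choice[OF this] obtain p where p1: "\<And>n. u n (p n) = 1"
    and p: "\<And>n y c. c \<in> {0..1} \<Longrightarrow> u n y \<le> u n (c *\<^sub>R y + (1 - c) *\<^sub>R p n)"
    by blast
  obtain N where "\<forall>m\<ge>N. \<forall>n\<ge>N. H_end (u m) (u n) < 1 / 2"
    using cauchy[of "1 / 2"] by auto
  then have N: "H_end (u n) (u N) < 1 / 2" if "N \<le> n" for n
    using that by blast
  have "bounded {x. 1 / 2 \<le> u N x}"
    by (intro S_nc_bounded_level[OF u]) auto
  then have "bounded {x. \<exists>w. fuzzy_set w \<and> 1 \<le> w x \<and> H_end w (u N) < 1 / 2}"
    by (rule bounded_level_nearby[OF fz]) simp_all
  moreover have "range (\<lambda>k. p (N + k)) \<subseteq> {x. \<exists>w. fuzzy_set w \<and> 1 \<le> w x \<and> H_end w (u N) < 1 / 2}"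
  proof (intro image_subsetI CollectI exI conjI)
    fix k
    show "fuzzy_set (u (N + k))" "1 \<le> u (N + k) (p (N + k))" "H_end (u (N + k)) (u N) < 1 / 2"
      by (simp_all only: fz p1 N le_add1 order_refl)
  qed
  ultimately have "bounded (range (\<lambda>k. p (N + k)))"
    by (rule bounded_subset)
  then obtain c0 r' where r': "strict_mono r'" and c0: "((\<lambda>k. p (N + k)) \<circ> r') \<longlonglongrightarrow> c0"
    using bounded_imp_convergent_subsequence by blast
  define r where "r k = N + r' k" for k
  have r: "strict_mono r"
    using r' by (simp add: r_def strict_mono_def)
  have pr: "(\<lambda>k. p (r k)) \<longlonglongrightarrow> c0"
    using c0 by (simp add: r_def o_def)

  \<comment> \<open>Only a subsequence of centres converges, so points of the limit are tracked along that subsequence too.\<close>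
  have "(c0, 1) \<in> endograph v"
    unfolding end_v
    by (rule L_subseq[OF r, of "\<lambda>k. p (r k)" "\<lambda>_. 1"]) (simp_all add: pr E_def mem_endograph p1)
  then have "v c0 = 1"
    using fuzzy_setD(2)[OF fz_v, of c0] by (simp add: mem_endograph)
  then have "normal_fuzzy v"
    unfolding normal_fuzzy_def by blast
  moreover have "fuzzy_star_shaped v"
    unfolding fuzzy_star_shaped_def
  proof (intro exI[of _ c0] allI ballI)
    fix x and c :: real assume "c \<in> {0..1}"
    have "(x, v x) \<in> L"
      unfolding end_v[symmetric] by (simp add: mem_endograph fuzzy_setD fz_v)
    then obtain y s where ys: "\<And>n. (y n, s n) \<in> E n" and x: "y \<longlonglongrightarrow> x" and t: "s \<longlonglongrightarrow> v x"
      using L_seq by blast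
    have "(c *\<^sub>R x + (1 - c) *\<^sub>R c0, v x) \<in> L"
    proof (rule L_subseq[OF r])
      show "(c *\<^sub>R y (r k) + (1 - c) *\<^sub>R p (r k), s (r k)) \<in> E (r k)" for k
        using ys[of "r k"] p[OF \<open>c \<in> {0..1}\<close>, of "r k" "y (r k)"] by (auto simp: E_def mem_endograph)
      show "(\<lambda>k. c *\<^sub>R y (r k) + (1 - c) *\<^sub>R p (r k)) \<longlonglongrightarrow> c *\<^sub>R x + (1 - c) *\<^sub>R c0"
        using LIMSEQ_subseq_LIMSEQ[OF x r] by (intro tendsto_intros pr) (simp add: o_def)
      show "(\<lambda>k. s (r k)) \<longlonglongrightarrow> v x"
        using LIMSEQ_subseq_LIMSEQ[OF t r] by (simp add: o_def)
    qed
    then show "v x \<le> v (c *\<^sub>R x + (1 - c) *\<^sub>R c0)"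
      unfolding end_v[symmetric] by (simp add: mem_endograph)
  qed
  ultimately have "v \<in> S_nc"
    using levels by (simp add: S_nc_iff fz_v end_v \<open>closed L\<close>)
  then show thesis
    using conv that by blast
qed

lemma mcomplete_S_nc: "Metric_space.mcomplete (S_nc :: (real ^ 'm \<Rightarrow> real) set) H_end"
proof -
  interpret Metric_space "S_nc :: (real ^ 'm \<Rightarrow> real) set" H_end
    by (rule Metric_space_S_nc)
  show ?thesis
    unfolding mcomplete_def
  proof (intro allI impI)
    fix u :: "nat \<Rightarrow> real ^ 'm \<Rightarrow> real" assume u: "MCauchy u"
    obtain v where v: "v \<in> S_nc" "\<And>e. 0 < e \<Longrightarrow> \<forall>\<^sub>F n in sequentially. H_end (u n) v \<le> e"
      using S_nc_Cauchy_converges[of u] u unfolding MCauchy_def by (metis range_subsetD)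
    have "limitin mtopology u v sequentially"
      unfolding limitin_metric
    proof (intro conjI v(1) allI impI)
      fix e :: real assume "0 < e"
      then have "\<forall>\<^sub>F n in sequentially. H_end (u n) v \<le> e / 2"
        by (intro v(2)) simp
      then show "\<forall>\<^sub>F n in sequentially. u n \<in> S_nc \<and> H_end (u n) v < e"
      proof eventually_elim
        case (elim n)
        then show ?case
          using u \<open>0 < e\<close> unfolding MCauchy_def by auto
      qed
    qed
    then show "\<exists>v. limitin mtopology u v sequentially"
      by blast
  qed
qed

section \<open>Density of the fuzzy star-shaped numbers\<close>

lemma S_c_subset_S_nc: "S_c \<subseteq> S_nc"
proof
  fix u :: "real ^ 'm \<Rightarrow> real" assume u: "u \<in> S_c"
  have "bounded (level_set u \<alpha>)" if "\<alpha> \<in> {0<..1}" for \<alpha>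
  proof (rule bounded_subset)
    show "bounded (level_set u 0)"
      using u by (simp add: S_c_def)
    show "level_set u \<alpha> \<subseteq> level_set u 0"
      using that closure_subset[of "{x. 0 < u x}"] by (auto simp: level_set_def)
  qed
  then show "u \<in> S_nc"
    using u by (simp add: S_c_def S_nc_def)
qed

definition truncate_below :: "real \<Rightarrow> ('a \<Rightarrow> real) \<Rightarrow> 'a \<Rightarrow> real" where
  "truncate_below e u x = (if e \<le> u x then u x else 0)"

lemma truncate_below_in_S_c:
  assumes "u \<in> S_nc" "0 < e" "e \<le> 1"
  shows "truncate_below e u \<in> S_c"
proof -
  have fz: "fuzzy_set u" and usc: "upper_semicontinuous u"
    using assms(1) by (simp_all add: S_nc_def)
  have fz': "fuzzy_set (truncate_below e u)"
    using fuzzy_setD[OF fz] by (auto simp: fuzzy_set_def truncate_below_def)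
  have "upper_semicontinuous (truncate_below e u)"
    unfolding upper_semicontinuous_def
  proof (intro allI impI)
    fix x and d :: real assume "0 < d"
    \<comment> \<open>Where \<open>u x < e\<close>, semicontinuity with slack \<open>e - u x\<close> shows that the truncation vanishes near \<open>x\<close>.\<close>
    have "\<forall>\<^sub>F y in nhds x. u y < u x + (if e \<le> u x then d else e - u x)"
      using usc \<open>0 < d\<close> unfolding upper_semicontinuous_def by auto
    then show "\<forall>\<^sub>F y in nhds x. truncate_below e u y < truncate_below e u x + d"
    proof eventually_elim
      case (elim y)
      then show ?case
        using \<open>0 < d\<close> fuzzy_setD(1)[OF fz, of x] by (auto simp: truncate_below_def split: if_splits)
    qed
  qed
  moreover have "normal_fuzzy (truncate_below e u)"
    using assms(1,3) by (auto simp: S_nc_def normal_fuzzy_def truncate_below_def)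
  moreover have "fuzzy_star_shaped (truncate_below e u)"
  proof -
    obtain x where x: "\<forall>y. \<forall>c\<in>{0..1}. u y \<le> u (c *\<^sub>R y + (1 - c) *\<^sub>R x)"
      using assms(1) unfolding S_nc_def fuzzy_star_shaped_def by blast
    have mono: "truncate_below e u y \<le> truncate_below e u z" if "u y \<le> u z" for y z
      using that fuzzy_setD(1)[OF fz, of z] by (auto simp: truncate_below_def)
    show ?thesis
      unfolding fuzzy_star_shaped_def using x mono by blast
  qed
  moreover have "bounded (level_set (truncate_below e u) 0)"
  proof -
    have "bounded {x. e \<le> u x}"
      using assms by (simp add: S_nc_iff)
    then have "bounded {x. 0 < truncate_below e u x}"
      by (rule bounded_subset) (auto simp: truncate_below_def split: if_splits)
    then show ?thesis
      by (simp add: level_set_def bounded_closure)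
  qed
  ultimately show ?thesis
    using fz' by (simp add: S_c_def)
qed

lemma H_end_truncate_below:
  assumes "fuzzy_set u" "0 < e"
  shows "H_end u (truncate_below e u) \<le> e"
proof -
  have fz: "fuzzy_set (truncate_below e u)"
    using fuzzy_setD[OF assms(1)] by (auto simp: fuzzy_set_def truncate_below_def)
  have "infdist (x, t) (endograph (truncate_below e u)) \<le> e" if "(x, t) \<in> endograph u" for x t
  proof (cases "e \<le> u x")
    case True
    then show ?thesis
      using that \<open>0 < e\<close> by (simp add: mem_endograph truncate_below_def)
  next
    case False
    then have "dist (x, t) (x, 0) \<le> e"
      using that by (simp add: dist_Pair_Pair mem_endograph)
    then show ?thesis
      using infdist_le2 endograph_ground[OF fz] by blast
  qed
  moreover have "endograph (truncate_below e u) \<subseteq> endograph u"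
    using fuzzy_setD[OF assms(1)] by (auto simp: endograph_def truncate_below_def split: if_splits)
  ultimately show ?thesis
    using assms by (auto simp: H_end_le_iff fz subset_iff)
qed

lemma S_c_dense: "Metric_space.mtopology S_nc H_end closure_of S_c = S_nc"
proof -
  interpret Metric_space S_nc H_end
    by (rule Metric_space_S_nc)
  have "\<exists>v\<in>S_c. v \<in> mcball u r" if u: "u \<in> S_nc" and "0 < r" for u and r :: real
  proof (intro bexI)
    define e where "e = min r 1"
    have e: "0 < e" "e \<le> 1" "e \<le> r"
      using \<open>0 < r\<close> by (auto simp: e_def)
    show v: "truncate_below e u \<in> S_c"
      by (rule truncate_below_in_S_c[OF u e(1,2)])
    have "H_end u (truncate_below e u) \<le> r"
      using H_end_truncate_below[of u e] u e by (auto simp: S_nc_iff)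
    then show "truncate_below e u \<in> mcball u r"
      using u v S_c_subset_S_nc by auto
  qed
  then show ?thesis
    unfolding metric_closure_of_alt by blast
qed

theorem theorem9p10:
  shows "Metric_space (S_nc :: (real ^ 'm \<Rightarrow> real) set) H_end
    \<and> Metric_space.mcomplete (S_nc :: (real ^ 'm \<Rightarrow> real) set) H_end
    \<and> (S_c :: (real ^ 'm \<Rightarrow> real) set) \<subseteq> S_nc
    \<and> Metric_space.mtopology (S_nc :: (real ^ 'm \<Rightarrow> real) set) H_end closure_of S_c = S_nc"
  by (intro conjI Metric_space_S_nc mcomplete_S_nc S_c_subset_S_nc S_c_dense)

end
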